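(* Let $G=(V,E)$ be a graph and let $k>0$ be a real number. Then the map $w\mapsto\varphi_k(G,w)$, defined for $w\in\mathbb{R}_+^V$, is a positive definite monotone gauge.
   Context: $A_G$ is the adjacency matrix of the graph $G=(V,E)$. For $w\in\mathbb{R}_+^V$ and nonnegative real $k$, $$\varphi_k(G,w)=\max\{\langle M,Y\rangle : M,Y\in\mathbb{S}^V_+,\ \operatorname{diag}(Y)=w,\ A_G\circ Y=0,\ \langle I,M\rangle=k,\ M\preceq I\},$$ where $\mathbb{S}^V_+$ is the set of positive semidefinite real symmetric $V\times V$ matrices, $I$ is the identity matrix, $\circ$ is the entrywise product, $\langle A,B\rangle=\operatorname{trace}(AB)$, $\operatorname{diag}(Y)$ is the vector of diagonal entries of $Y$, and $A\preceq B$ means that $B-A$ is positive semidefinite. A function $\kappa\colon\mathbb{R}_+^V\to\mathbb{R}$ is a positive definite gauge if $\kappa(x)\ge0$ for all $x\in\mathbb{R}_+^V$, with equality if and only if $x=0$; $\kappa(\lambda x)=\lambda\kappa(x)$ for all $\lambda\in\mathbb{R}_+$ and $x\in\mathbb{R}_+^V$; and $\kappa(x+y)\le\kappa(x)+\kappa(y)$ for all $x,y\in\mathbb{R}_+^V$. It is monotone if $\kappa(x)\le\kappa(y)$ whenever $x\le y$ entrywise.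
   Formalization: The real number k is assumed to satisfy 0 < k ≤ |V|; for k > |V| the constraints ⟨I,M⟩ = k and M ⪯ I cannot both hold, so the maximum defining φ_k(G,w) is over the empty set and is undefined. *)

theory Defs
  imports "HOL-Analysis.Analysis"
begin

text \<open>
  The vertex set of a graph is the finite type \<open>'v\<close>, and a graph is given by its set \<open>E\<close> of
  edges, each a two-element set of vertices. Vectors and matrices indexed by the vertices are
  \<open>real^'v\<close> and \<open>real^'v^'v\<close>. On \<open>real^'v\<close> the library order is the entrywise one, so
  the nonnegative orthant is \<open>{0..}\<close>.
\<close>

definition adj_matrix :: "'v set set \<Rightarrow> real^'v^'v" where
  "adj_matrix E = (\<chi> i j. if {i, j} \<in> E then 1 else 0)"

definition psd :: "real^'v^'v \<Rightarrow> bool" where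
  "psd A \<longleftrightarrow> transpose A = A \<and> (\<forall>x. 0 \<le> x \<bullet> (A *v x))"

definition loewner_le :: "real^'v^'v \<Rightarrow> real^'v^'v \<Rightarrow> bool" where
  "loewner_le A B \<longleftrightarrow> psd (B - A)"

definition entrywise_prod :: "real^'v^'v \<Rightarrow> real^'v^'v \<Rightarrow> real^'v^'v" where
  "entrywise_prod A B = (\<chi> i j. A $ i $ j * B $ i $ j)"

definition trace_inner :: "real^'v^'v \<Rightarrow> real^'v^'v \<Rightarrow> real" where
  "trace_inner A B = trace (A ** B)"

definition diag_vec :: "real^'v^'v \<Rightarrow> real^'v" where
  "diag_vec A = (\<chi> i. A $ i $ i)"

text \<open>
  \<open>GREATEST\<close> denotes an attained maximum: it is specified only if the set of feasible values has
  a largest element. In particular, \<open>phi k E w\<close> is unspecified when no pair \<open>(M, Y)\<close> is feasible.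
\<close>

definition phi :: "real \<Rightarrow> 'v set set \<Rightarrow> real^'v \<Rightarrow> real" where
  "phi k E w = (GREATEST t. \<exists>M Y. t = trace_inner M Y \<and> psd M \<and> psd Y \<and>
     diag_vec Y = w \<and> entrywise_prod (adj_matrix E) Y = 0 \<and>
     trace_inner (mat 1) M = k \<and> loewner_le M (mat 1))"

text \<open>Only the values of \<open>\<kappa>\<close> on the nonnegative orthant matter below.\<close>

definition positive_definite_gauge :: "(real^'v \<Rightarrow> real) \<Rightarrow> bool" where
  "positive_definite_gauge \<kappa> \<longleftrightarrow>
     (\<forall>x\<ge>0. 0 \<le> \<kappa> x \<and> (\<kappa> x = 0 \<longleftrightarrow> x = 0)) \<and>
     (\<forall>c\<ge>0. \<forall>x\<ge>0. \<kappa> (c *\<^sub>R x) = c * \<kappa> x) \<and>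
     (\<forall>x\<ge>0. \<forall>y\<ge>0. \<kappa> (x + y) \<le> \<kappa> x + \<kappa> y)"

end

theory Submission
  imports Defs
begin

text \<open>
  Subadditivity is the only property that needs an idea; the obstacle is that \<open>phi k E w\<close>
  maximises \<open>\<langle>M, Y\<rangle>\<close>, and \<open>Y\<close> depends on \<open>w\<close> in a nonlinear way. Write \<open>Y = C C\<^sup>T\<close>. The
  \<open>i\<close>th row of \<open>C\<close> is \<open>\<surd>w\<^sub>i p\<^sub>i\<close> for unit vectors \<open>p\<^sub>i\<close> that are orthogonal along edges, so that
  \<open>C\<^sup>T C = \<Sum> w\<^sub>i p\<^sub>i p\<^sub>i\<^sup>T\<close> is linear in \<open>w\<close> once the \<open>p\<^sub>i\<close> are fixed. Moreover \<open>C C\<^sup>T\<close> and \<open>C\<^sup>T C\<close>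
  are orthogonally similar, and the constraints on \<open>M\<close> are invariant under orthogonal conjugation.
  Hence \<open>phi k E w\<close> is also the maximum of the functions \<open>\<Sum> w\<^sub>i p\<^sub>i\<^sup>T N p\<^sub>i\<close> over all \<open>p\<close> and all
  admissible \<open>N\<close>: a maximum of linear functions of \<open>w\<close>, and so sublinear. The proof in
  \<open>phi_subadditive\<close> carries this out without the vectors \<open>p\<^sub>i\<close>: it splits \<open>C\<^sup>T C\<close> according to
  \<open>w = x + y\<close> by rescaling the rows of \<open>C\<close>, and passes between \<open>C C\<^sup>T\<close> and \<open>C\<^sup>T C\<close> by
  \<open>gram_swap\<close>.

  Two facts of matrix theory support this. The factorisation \<open>Y = C C\<^sup>T\<close> comes from
  Cholesky elimination (\<open>psd_cholesky_on\<close>). The similarity comes from a polar decomposition, that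
  is, an orthogonal \<open>U\<close> with \<open>U C\<close> symmetric (\<open>orthogonal_symmetrizer\<close>); a maximiser of
  \<open>trace (U C)\<close> over the orthogonal group has this property.

  The other properties compare feasible pairs directly. The maximum exists by compactness
  (\<open>phi_is_maximum\<close>), adding the diagonal matrix of \<open>y - x\<close> to a feasible \<open>Y\<close> gives monotonicity,
  scaling \<open>Y\<close> gives homogeneity, and the feasible matrix \<open>M = (k / n) I\<close>, where \<open>n\<close> is the number
  of vertices, gives the lower bound \<open>(k / n) \<Sum> w\<^sub>i\<close>, which is positive unless \<open>w = 0\<close>.
\<close>

section \<open>Positive semidefinite matrices\<close>

lemma quadratic_form_sandwich:
  fixes A :: "real^'n^'n" and B :: "real^'n^'m"
  shows "x \<bullet> ((B ** A ** transpose B) *v x) = (transpose B *v x) \<bullet> (A *v (transpose B *v x))"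
  by (metis dot_lmul_matrix matrix_vector_mul_assoc transpose_matrix_vector)

lemma psd_sandwich:
  assumes "psd A"
  shows "psd (B ** A ** transpose B)"
  using assms unfolding psd_def quadratic_form_sandwich
  by (simp add: matrix_transpose_mul matrix_mul_assoc)

lemma psd_mat_1: "psd (mat 1 :: real^'n^'n)"
  by (simp add: psd_def)

lemma psd_gram: "psd (C ** transpose C)"
  using psd_sandwich[OF psd_mat_1, of C] by simp

lemma psd_add:
  assumes "psd A" and "psd B"
  shows "psd (A + B)"
  using assms unfolding psd_def
  by (auto simp: matrix_vector_mult_add_rdistrib inner_add_right transpose_def vec_eq_iff)

lemma psd_scaleR:
  assumes "psd A" and "0 \<le> c"
  shows "psd (c *\<^sub>R A)"
  using assms unfolding psd_def
  by (auto simp: scaleR_matrix_vector_assoc[symmetric] transpose_def vec_eq_iff)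

definition diag_mat :: "real^'n \<Rightarrow> real^'n^'n" where
  "diag_mat d = (\<chi> i j. if i = j then d $ i else 0)"

lemma diag_mat_mult_nth: "(diag_mat d ** A) $ i $ j = d $ i * A $ i $ j"
  unfolding matrix_matrix_mult_def diag_mat_def
  by (simp add: if_distrib[of "\<lambda>x. x * _"] cong: if_cong)

lemma mult_diag_mat_nth: "(A ** diag_mat d) $ i $ j = A $ i $ j * d $ j"
  unfolding matrix_matrix_mult_def diag_mat_def
  by (simp add: if_distrib[of "\<lambda>x. _ * x"] cong: if_cong)

lemma transpose_diag_mat: "transpose (diag_mat d) = diag_mat d"
  by (auto simp: transpose_def diag_mat_def vec_eq_iff)

lemma psd_diag_mat:
  assumes "0 \<le> d"
  shows "psd (diag_mat d)"
proof -
  let ?r = "diag_mat (\<chi> i. sqrt (d $ i))"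
  have "diag_mat d = ?r ** transpose ?r"
    using assms
    by (auto simp: vec_eq_iff transpose_diag_mat diag_mat_mult_nth less_eq_vec_def)
       (auto simp: diag_mat_def)
  then show ?thesis
    using psd_gram by metis
qed

lemma psd_sym: "psd A \<Longrightarrow> A $ i $ j = A $ j $ i"
  unfolding psd_def by (metis transpose_def vec_lambda_beta)

lemma psd_diag_nonneg: "psd A \<Longrightarrow> 0 \<le> A $ i $ i"
  unfolding psd_def
  by (metis column_def inner_axis' inner_real_def
      matrix_vector_mult_basis mult_1 vec_lambda_beta)

text \<open>
  Nonnegativity of the form on the plane spanned by \<open>x\<close> and \<open>y\<close>. The form may be degenerate, so the
  usual minimisation along a line needs \<open>y\<close> to be non-null; otherwise the form is affine along
  the line in the direction of \<open>y\<close>, and boundedness below forces its slope to vanish.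
\<close>

lemma psd_Cauchy_Schwarz:
  fixes A :: "real^'n^'n"
  assumes "psd A"
  shows "(x \<bullet> (A *v y))\<^sup>2 \<le> (x \<bullet> (A *v x)) * (y \<bullet> (A *v y))"
proof -
  define p q r where "p = x \<bullet> (A *v x)" and "q = x \<bullet> (A *v y)" and "r = y \<bullet> (A *v y)"
  have "y \<bullet> (A *v x) = q"
    using assms unfolding psd_def q_def
    by (metis dot_lmul_matrix inner_commute transpose_matrix_vector)
  then have form: "0 \<le> a\<^sup>2 * p + 2 * (a * b) * q + b\<^sup>2 * r" for a b
  proof -
    have "0 \<le> (a *\<^sub>R x + b *\<^sub>R y) \<bullet> (A *v (a *\<^sub>R x + b *\<^sub>R y))"
      using assms unfolding psd_def by blast
    also have "\<dots> = a\<^sup>2 * p + 2 * (a * b) * q + b\<^sup>2 * r"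
      using \<open>y \<bullet> (A *v x) = q\<close> unfolding p_def r_def
      by (simp add: matrix_vector_right_distrib matrix_vector_mult_scaleR inner_add_left
          inner_add_right power2_eq_square algebra_simps q_def)
    finally show ?thesis .
  qed
  show ?thesis
  proof (cases "r = 0")
    case False
    then have "r > 0" using assms unfolding psd_def r_def by (simp add: order_less_le)
    have "0 \<le> r * (p * r - q\<^sup>2)"
      using form[of r "-q"] by (simp add: power2_eq_square algebra_simps)
    with \<open>r > 0\<close> show ?thesis
      unfolding p_def[symmetric] q_def[symmetric] r_def[symmetric]
      by (simp add: zero_le_mult_iff)
  next
    case True
    have "q = 0"
    proof (rule ccontr)
      assume "q \<noteq> 0"
      have "0 \<le> p + 2 * (- (p + 1) / (2 * q)) * q"
        using form[of 1 "- (p + 1) / (2 * q)"] True by simp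
      with \<open>q \<noteq> 0\<close> show False by (simp add: field_simps)
    qed
    with True show ?thesis
      unfolding p_def[symmetric] q_def[symmetric] r_def[symmetric] by simp
  qed
qed

lemma inner_matrix_axis: "x \<bullet> (A *v axis j 1) = x \<bullet> column j A" for A :: "real^'n^'n"
  by (simp add: matrix_vector_mult_basis)

lemma axis_matrix_axis: "axis i 1 \<bullet> (A *v axis j 1) = A $ i $ j" for A :: "real^'n^'n"
  by (simp add: matrix_vector_mult_basis inner_axis' column_def)

lemma psd_entry_le_trace:
  fixes A :: "real^'n^'n"
  assumes "psd A"
  shows "\<bar>A $ i $ j\<bar> \<le> trace A"
proof -
  have le: "A $ l $ l \<le> trace A" for l
    unfolding trace_def using assms by (intro member_le_sum) (auto intro: psd_diag_nonneg)
  have "(A $ i $ j)\<^sup>2 \<le> A $ i $ i * A $ j $ j"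
    using psd_Cauchy_Schwarz[OF assms, of "axis i 1" "axis j 1"] by (simp add: axis_matrix_axis)
  also have "\<dots> \<le> (trace A)\<^sup>2"
    unfolding power2_eq_square
    using le psd_diag_nonneg[OF assms] by (meson mult_mono order_trans)
  finally show ?thesis
    using le[of i] psd_diag_nonneg[OF assms, of i] by (metis abs_le_square_iff abs_of_nonneg order_trans)
qed

text \<open>
  Cholesky elimination: with \<open>c = A e\<^sub>p / \<surd>A\<^sub>p\<^sub>p\<close>, the matrix \<open>A - c c\<^sup>T\<close> is again positive
  semidefinite by Cauchy-Schwarz, its \<open>p\<close>th row vanishes, and rows that were zero stay
  zero. The set \<open>S\<close> records the pivots still to be eliminated; the columns of \<open>C\<close> outside \<open>S\<close> are
  zero so that \<open>c\<close> can be stored in column \<open>p\<close>.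
\<close>

lemma psd_cholesky_on:
  fixes A :: "real^'n^'n"
  assumes "finite S" and "psd A" and "\<And>j. j \<notin> S \<Longrightarrow> A $ j $ j = 0"
  shows "\<exists>C :: real^'n^'n. A = C ** transpose C \<and> (\<forall>i j. j \<notin> S \<longrightarrow> C $ i $ j = 0)"
  using assms
proof (induction S arbitrary: A rule: finite_induct)
  case empty
  then have "A $ i $ j = 0" for i j
    using psd_entry_le_trace[of A i j] by (simp add: trace_def)
  then have "A = 0 ** transpose (0 :: real^'n^'n)"
    by (simp add: vec_eq_iff matrix_matrix_mult_def)
  then show ?case by (intro exI[of _ 0]) simp
next
  case (insert p S)
  have zero_row: "A $ i $ j = 0" if "A $ j $ j = 0" for i j
    using psd_Cauchy_Schwarz[OF insert.prems(1), of "axis i 1" "axis j 1"] that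
    by (simp add: axis_matrix_axis)
  \<comment> \<open>For a zero pivot the division convention gives \<open>c = 0\<close>, and nothing is eliminated.\<close>
  define c where "c = (1 / sqrt (A $ p $ p)) *\<^sub>R column p A"
  define B where "B = (\<chi> i j. A $ i $ j - c $ i * c $ j)"
  have c_nth: "c $ i = A $ i $ p / sqrt (A $ p $ p)" for i
    by (simp add: c_def column_def)
  have form: "x \<bullet> (B *v x) = x \<bullet> (A *v x) - (x \<bullet> c)\<^sup>2" for x
    unfolding B_def inner_vec_def matrix_vector_mult_def
    by (simp add: power2_eq_square sum_product sum_subtractf algebra_simps sum_distrib_left)
  have "psd B"
    unfolding psd_def
  proof (intro conjI allI)
    show "transpose B = B"
      using psd_sym[OF insert.prems(1)] by (simp add: vec_eq_iff transpose_def B_def)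
    fix x
    show "0 \<le> x \<bullet> (B *v x)"
    proof (cases "A $ p $ p = 0")
      case True
      with insert.prems(1) show ?thesis by (simp add: form c_def psd_def)
    next
      case False
      then have pos: "A $ p $ p > 0"
        using psd_diag_nonneg[OF insert.prems(1), of p] by simp
      have "(x \<bullet> c)\<^sup>2 = (x \<bullet> column p A)\<^sup>2 / A $ p $ p"
        using pos by (simp add: c_def power_mult_distrib power_divide)
      also have "\<dots> \<le> x \<bullet> (A *v x)"
        using psd_Cauchy_Schwarz[OF insert.prems(1), of x "axis p 1"] pos
        unfolding axis_matrix_axis[of p A p] inner_matrix_axis[of x A p]
        by (simp add: divide_le_eq)
      finally show ?thesis by (simp add: form)
    qed
  qed
  moreover have "B $ j $ j = 0" if "j \<notin> S" for j
  proof (cases "j = p")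
    case True
    then show ?thesis
      using psd_diag_nonneg[OF insert.prems(1), of p] zero_row
      by (simp add: B_def c_nth real_div_sqrt)
  next
    case False
    with that have "A $ j $ j = 0" by (simp add: insert.prems(2))
    moreover from this have "A $ j $ p = 0"
      using zero_row psd_sym[OF insert.prems(1)] by metis
    ultimately show ?thesis by (simp add: B_def c_nth)
  qed
  ultimately obtain C :: "real^'n^'n"
    where C: "B = C ** transpose C" "\<And>i j. j \<notin> S \<Longrightarrow> C $ i $ j = 0"
    using insert.IH by blast
  define C' :: "real^'n^'n" where "C' = (\<chi> i j. if j = p then c $ i else C $ i $ j)"
  have "A $ i $ j = (C' ** transpose C') $ i $ j" for i j
  proof -
    have "A $ i $ j = B $ i $ j + c $ i * c $ j" by (simp add: B_def)
    also have "B $ i $ j = (\<Sum>l\<in>UNIV. C $ i $ l * C $ j $ l)"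
      by (simp add: C matrix_matrix_mult_def transpose_def)
    also have "\<dots> = (\<Sum>l\<in>UNIV - {p}. C $ i $ l * C $ j $ l)"
      using C(2) insert.hyps by (simp add: sum.remove[of UNIV p])
    also have "\<dots> = (\<Sum>l\<in>UNIV - {p}. C' $ i $ l * C' $ j $ l)"
      by (intro sum.cong) (auto simp: C'_def)
    also have "\<dots> + c $ i * c $ j = (\<Sum>l\<in>UNIV. C' $ i $ l * C' $ j $ l)"
      by (simp add: sum.remove[of UNIV p] C'_def)
    finally show ?thesis by (simp add: matrix_matrix_mult_def transpose_def)
  qed
  then have "A = C' ** transpose C'" by (simp add: vec_eq_iff)
  moreover have "\<forall>i j. j \<notin> insert p S \<longrightarrow> C' $ i $ j = 0"
    using C(2) by (simp add: C'_def)
  ultimately show ?case by blast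
qed

lemma psd_obtain_factor:
  assumes "psd (A :: real^'n^'n)"
  obtains C :: "real^'n^'n" where "A = C ** transpose C"
  using psd_cholesky_on[OF finite assms, of UNIV] by auto

section \<open>Compactness and polar decomposition\<close>

lemma compact_matrices:
  fixes S :: "(real^'n^'n) set"
  assumes "closed S" and "\<And>A i j. A \<in> S \<Longrightarrow> \<bar>A $ i $ j\<bar> \<le> r"
  shows "compact S"
proof -
  have "norm A \<le> (\<Sum>i\<in>(UNIV :: 'n set). \<Sum>j\<in>(UNIV :: 'n set). r)" if "A \<in> S" for A
  proof -
    have "norm (A $ i) \<le> (\<Sum>j\<in>(UNIV :: 'n set). r)" for i
      using norm_le_l1_cart[of "A $ i"] assms(2)[OF that]
      by (meson order_trans sum_mono)
    then have "(\<Sum>i\<in>UNIV. norm (A $ i)) \<le> (\<Sum>i\<in>(UNIV :: 'n set). \<Sum>j\<in>(UNIV :: 'n set). r)"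
      by (intro sum_mono)
    moreover have "norm A \<le> (\<Sum>i\<in>UNIV. norm (A $ i))"
      unfolding norm_vec_def by (rule L2_set_le_sum) simp
    ultimately show ?thesis by linarith
  qed
  with assms(1) show ?thesis
    by (meson bounded_iff compact_eq_bounded_closed)
qed

lemma continuous_on_matrix_mult [continuous_intros]:
  fixes f g :: "'a::topological_space \<Rightarrow> real^'n^'n"
  assumes "continuous_on S f" and "continuous_on S g"
  shows "continuous_on S (\<lambda>x. f x ** g x)"
  unfolding matrix_matrix_mult_def by (intro continuous_intros assms)

lemma continuous_on_transpose [continuous_intros]:
  fixes f :: "'a::topological_space \<Rightarrow> real^'n^'n"
  assumes "continuous_on S f"
  shows "continuous_on S (\<lambda>x. transpose (f x))"
  unfolding transpose_def by (intro continuous_intros assms)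

lemma continuous_on_trace [continuous_intros]:
  fixes f :: "'a::topological_space \<Rightarrow> real^'n^'n"
  assumes "continuous_on S f"
  shows "continuous_on S (\<lambda>x. trace (f x))"
  unfolding trace_def by (intro continuous_intros assms)

lemma closed_psd_preimage:
  fixes f :: "real^'n^'n \<Rightarrow> real^'n^'n"
  assumes "continuous_on UNIV f"
  shows "closed {A. psd (f A)}"
  unfolding psd_def matrix_vector_mult_def
  by (intro closed_Collect_conj closed_Collect_all closed_Collect_eq closed_Collect_le
      continuous_intros assms)

lemma compact_orthogonal_matrices: "compact {U :: real^'n^'n. orthogonal_matrix U}"
proof (rule compact_matrices[where r = 1])
  show "closed {U :: real^'n^'n. orthogonal_matrix U}"
    unfolding orthogonal_matrix_def
    by (intro closed_Collect_conj closed_Collect_eq continuous_intros)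
  fix U :: "real^'n^'n" and i j
  assume "U \<in> {U. orthogonal_matrix U}"
  then have "norm (row i U) = 1"
    by (simp add: orthogonal_matrix_orthonormal_rows)
  then show "\<bar>U $ i $ j\<bar> \<le> 1"
    using component_le_norm_cart[of "row i U" j] by (simp add: row_def)
qed

text \<open>
  Only two diagonal entries change under a rotation of the coordinates \<open>i\<close> and \<open>j\<close>, so the trace of
  the rotated matrix is an explicit linear function of the cosine \<open>c\<close> and the sine \<open>s\<close>.
\<close>

lemma plane_rotation:
  fixes i j :: "'n::finite" and c s :: real
  assumes "i \<noteq> j" and "c\<^sup>2 + s\<^sup>2 = 1"
  obtains G :: "real^'n^'n" where "orthogonal_matrix G"
    and "\<And>A :: real^'n^'n. trace (G ** A) =
           trace A - (A $ i $ i + A $ j $ j) + c * (A $ i $ i + A $ j $ j) + s * (A $ i $ j - A $ j $ i)"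
proof
  define f :: "real^'n \<Rightarrow> real^'n" where
    "f = (\<lambda>x. \<chi> a. if a = i then c * x $ i - s * x $ j
                   else if a = j then s * x $ i + c * x $ j else x $ a)"
  have split: "(\<Sum>a\<in>UNIV. h a) = h i + h j + (\<Sum>a\<in>UNIV - {i} - {j}. h a)" for h :: "'n \<Rightarrow> real"
    using assms(1) by (simp add: sum.remove[of UNIV i] sum.remove[of "UNIV - {i}" j])
  have lin: "linear f"
    by (rule linearI) (auto simp: f_def vec_eq_iff algebra_simps)
  have "f v \<bullet> f w = v \<bullet> w" for v w
  proof -
    have "f v \<bullet> f w = (c\<^sup>2 + s\<^sup>2) * (v $ i * w $ i + v $ j * w $ j)
        + (\<Sum>a\<in>UNIV - {i} - {j}. v $ a * w $ a)"
      using assms(1) unfolding inner_vec_def split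
      by (simp add: f_def power2_eq_square algebra_simps)
    then show ?thesis
      unfolding assms(2) inner_vec_def split by simp
  qed
  with lin show "orthogonal_matrix (matrix f)"
    using orthogonal_transformation_matrix[of f] unfolding orthogonal_transformation_def by blast
  fix A :: "real^'n^'n"
  have "(matrix f ** A) $ a $ b = f (column b A) $ a" for a b
  proof -
    have "(matrix f ** A) $ a $ b = (matrix f *v column b A) $ a"
      by (simp add: matrix_matrix_mult_def matrix_vector_mult_def column_def)
    then show ?thesis using lin by (simp add: matrix_works)
  qed
  then show "trace (matrix f ** A) =
      trace A - (A $ i $ i + A $ j $ j) + c * (A $ i $ i + A $ j $ j) + s * (A $ i $ j - A $ j $ i)"
    using assms(1) unfolding trace_def split by (simp add: f_def column_def algebra_simps)
qed

text \<open>
  A maximiser \<open>U\<close> of \<open>trace (U C)\<close> works: were \<open>A = U C\<close> not symmetric at \<open>i\<close> and \<open>j\<close>, a rotation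
  in that plane would increase the trace. This gives \<open>C = U\<^sup>T T\<close> with \<open>T\<close> symmetric, which is all of
  the polar decomposition that \<open>gram_swap\<close> uses, and it covers singular \<open>C\<close> too.
\<close>

lemma orthogonal_symmetrizer:
  fixes C :: "real^'n^'n"
  obtains U :: "real^'n^'n" where "orthogonal_matrix U" and "transpose (U ** C) = U ** C"
proof -
  have "\<exists>U\<in>{U. orthogonal_matrix U}. \<forall>W\<in>{U. orthogonal_matrix U}. trace (W ** C) \<le> trace (U ** C)"
    by (rule continuous_attains_sup[OF compact_orthogonal_matrices])
       (use orthogonal_matrix_id in blast, intro continuous_intros)
  then obtain U where U: "orthogonal_matrix U"
    and max: "\<And>W. orthogonal_matrix W \<Longrightarrow> trace (W ** C) \<le> trace (U ** C)"
    by blast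
  define A where "A = U ** C"
  have "A $ i $ j = A $ j $ i" for i j
  proof (rule ccontr)
    assume neq: "A $ i $ j \<noteq> A $ j $ i"
    then have "i \<noteq> j" by auto
    define a b where "a = A $ i $ i + A $ j $ j" and "b = A $ i $ j - A $ j $ i"
    define r where "r = sqrt (a\<^sup>2 + b\<^sup>2)"
    \<comment> \<open>The unit vector \<open>(c, s) = (a, b) / r\<close> maximises \<open>c a + s b\<close>, with value \<open>r > a\<close>.\<close>
    have "b \<noteq> 0" using neq by (simp add: b_def)
    then have "r > 0" and r2: "r\<^sup>2 = a\<^sup>2 + b\<^sup>2"
      by (simp_all add: r_def sum_power2_gt_zero_iff)
    have "a\<^sup>2 + b\<^sup>2 \<noteq> 0" using \<open>b \<noteq> 0\<close> by (simp add: sum_power2_eq_zero_iff)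
    with r2 have "(a / r)\<^sup>2 + (b / r)\<^sup>2 = 1"
      by (simp add: power_divide flip: add_divide_distrib)
    then obtain G :: "real^'n^'n" where G: "orthogonal_matrix G"
      and trG: "trace (G ** A) = trace A - a + a / r * a + b / r * b"
      using plane_rotation[OF \<open>i \<noteq> j\<close>, of "a / r" "b / r"] unfolding a_def b_def by metis
    have "trace (G ** A) \<le> trace A"
      using max[OF orthogonal_matrix_mul[OF G U]] by (simp add: A_def matrix_mul_assoc)
    moreover have "a / r * a + b / r * b = r"
      using \<open>r > 0\<close> r2 by (simp add: field_simps power2_eq_square)
    ultimately have "r \<le> a" using trG by linarith
    then have "r\<^sup>2 \<le> a\<^sup>2" using \<open>r > 0\<close> by simp
    with r2 \<open>b \<noteq> 0\<close> show False by simp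
  qed
  then have "transpose (U ** C) = U ** C"
    by (simp add: vec_eq_iff transpose_def A_def)
  with U show thesis by (rule that)
qed

section \<open>The feasible matrices and attainment\<close>

text \<open>
  For an integer \<open>k\<close> this is the convex hull of the orthogonal projections of rank \<open>k\<close>.
\<close>

definition fractional_projections :: "real \<Rightarrow> (real^'v^'v) set" where
  "fractional_projections k =
     {M. psd M \<and> trace_inner (mat 1) M = k \<and> loewner_le M (mat 1)}"

text \<open>
  These are the Gram matrices of vectors of squared lengths \<open>w\<close> that are orthogonal along edges.
\<close>

definition weighted_gram_matrices :: "'v set set \<Rightarrow> real^'v \<Rightarrow> (real^'v^'v) set" where
  "weighted_gram_matrices E w =
     {Y. psd Y \<and> diag_vec Y = w \<and> entrywise_prod (adj_matrix E) Y = 0}"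

lemma entrywise_prod_adj_matrix_eq_0_iff:
  "entrywise_prod (adj_matrix E) Y = 0 \<longleftrightarrow> (\<forall>i j. {i, j} \<in> E \<longrightarrow> Y $ i $ j = 0)"
  by (auto simp: entrywise_prod_def adj_matrix_def vec_eq_iff)

lemma trace_inner_add_right: "trace_inner M (A + B) = trace_inner M A + trace_inner M B"
  by (simp add: trace_inner_def matrix_add_ldistrib trace_add)

lemma trace_inner_scaleR_right: "trace_inner M (c *\<^sub>R A) = c * trace_inner M A"
  by (simp add: trace_inner_def trace_def matrix_matrix_mult_def sum_distrib_left mult_ac)

lemma trace_inner_scaleR_left: "trace_inner (c *\<^sub>R M) A = c * trace_inner M A"
  by (simp add: trace_inner_def trace_def matrix_matrix_mult_def sum_distrib_left mult_ac)

lemma trace_inner_mat_1: "trace_inner (mat 1) A = trace A"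
  by (simp add: trace_inner_def)

lemma compact_fractional_projections: "compact (fractional_projections k :: (real^'v^'v) set)"
proof (rule compact_matrices)
  show "closed (fractional_projections k :: (real^'v^'v) set)"
    unfolding fractional_projections_def loewner_le_def trace_inner_mat_1
    by (intro closed_Collect_conj closed_psd_preimage closed_Collect_eq continuous_intros)
  show "\<bar>M $ i $ j\<bar> \<le> k" if "M \<in> fractional_projections k" for M :: "real^'v^'v" and i j
    using that psd_entry_le_trace[of M i j]
    by (simp add: fractional_projections_def trace_inner_mat_1)
qed

lemma trace_weighted_gram_matrix:
  "Y \<in> weighted_gram_matrices E w \<Longrightarrow> trace Y = (\<Sum>i\<in>UNIV. w $ i)"
  by (auto simp: weighted_gram_matrices_def diag_vec_def trace_def)

lemma compact_weighted_gram_matrices: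
  "compact (weighted_gram_matrices E w :: (real^'v^'v) set)"
proof (rule compact_matrices)
  show "closed (weighted_gram_matrices E w :: (real^'v^'v) set)"
    unfolding weighted_gram_matrices_def diag_vec_def entrywise_prod_def
    by (intro closed_Collect_conj closed_psd_preimage closed_Collect_eq continuous_intros)
  show "\<bar>Y $ i $ j\<bar> \<le> (\<Sum>i\<in>UNIV. w $ i)"
    if "Y \<in> weighted_gram_matrices E w" for Y :: "real^'v^'v" and i j
    using that psd_entry_le_trace[of Y i j] trace_weighted_gram_matrix[OF that]
    by (simp add: weighted_gram_matrices_def)
qed

lemma scaled_identity_fractional_projection:
  assumes "0 \<le> k" and "k \<le> real CARD('v)"
  shows "(k / real CARD('v)) *\<^sub>R mat 1 \<in> (fractional_projections k :: (real^'v::finite^'v) set)"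
proof -
  let ?t = "k / real CARD('v)"
  have "mat 1 - ?t *\<^sub>R mat 1 = (1 - ?t) *\<^sub>R (mat 1 :: real^'v^'v)"
    by (simp add: scaleR_left_diff_distrib)
  moreover have "?t \<le> 1"
    using assms by simp
  ultimately have "psd (mat 1 - ?t *\<^sub>R mat 1 :: real^'v^'v)"
    by (simp add: psd_scaleR psd_mat_1)
  moreover have "trace_inner (mat 1) (?t *\<^sub>R mat 1 :: real^'v^'v) = k"
    unfolding trace_inner_scaleR_right trace_inner_mat_1 trace_I by simp
  ultimately show ?thesis
    using assms by (simp add: fractional_projections_def loewner_le_def psd_scaleR psd_mat_1)
qed

lemma diag_mat_weighted_gram:
  assumes "\<forall>e\<in>E. card e = 2" and "0 \<le> w"
  shows "diag_mat w \<in> weighted_gram_matrices E w"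
proof -
  have "i \<noteq> j" if "{i, j} \<in> E" for i j
    using assms(1) that by force
  then show ?thesis
    using psd_diag_mat[OF assms(2)]
    unfolding weighted_gram_matrices_def entrywise_prod_adj_matrix_eq_0_iff
    by (auto simp: diag_vec_def diag_mat_def vec_eq_iff)
qed

text \<open>
  The two feasible sets are compact, since the entries of a positive semidefinite matrix are bounded
  by its trace, and the trace is prescribed in both. They are nonempty thanks to \<open>k \<le> n\<close>, with \<open>n\<close>
  the number of vertices, and to the absence of loops. All later arguments reason about \<open>phi\<close>
  through these two facts only.
\<close>

lemma phi_is_maximum:
  fixes E :: "'v::finite set set"
  assumes "\<forall>e\<in>E. card e = 2" and "0 \<le> k" and "k \<le> real CARD('v)" and "0 \<le> w"
  shows phi_attained: "\<exists>M\<in>fractional_projections k. \<exists>Y\<in>weighted_gram_matrices E w.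
      phi k E w = trace_inner M Y" (is ?attained)
    and phi_upper: "\<And>M Y. M \<in> fractional_projections k \<Longrightarrow> Y \<in> weighted_gram_matrices E w \<Longrightarrow>
      trace_inner M Y \<le> phi k E w"
proof -
  let ?F = "(fractional_projections k :: (real^'v^'v) set) \<times> weighted_gram_matrices E w"
  let ?P = "\<lambda>t. \<exists>M Y. t = trace_inner M Y \<and> psd M \<and> psd Y \<and>
     diag_vec Y = w \<and> entrywise_prod (adj_matrix E) Y = 0 \<and>
     trace_inner (mat 1) M = k \<and> loewner_le M (mat 1)"
  have P_iff: "?P t \<longleftrightarrow> (\<exists>M\<in>fractional_projections k. \<exists>Y\<in>weighted_gram_matrices E w.
      t = trace_inner M Y)" for t
    unfolding fractional_projections_def weighted_gram_matrices_def by blast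
  have "\<exists>p\<in>?F. \<forall>q\<in>?F. trace_inner (fst q) (snd q) \<le> trace_inner (fst p) (snd p)"
  proof (rule continuous_attains_sup)
    show "compact ?F"
      by (intro compact_Times compact_fractional_projections compact_weighted_gram_matrices)
    show "?F \<noteq> {}"
      using scaled_identity_fractional_projection[OF assms(2,3)]
        diag_mat_weighted_gram[OF assms(1,4)] by blast
    show "continuous_on ?F (\<lambda>q. trace_inner (fst q) (snd q))"
      unfolding trace_inner_def by (intro continuous_intros)
  qed
  then obtain M0 Y0 where "M0 \<in> fractional_projections k" "Y0 \<in> weighted_gram_matrices E w"
    and max0: "\<And>M Y. M \<in> fractional_projections k \<Longrightarrow> Y \<in> weighted_gram_matrices E w \<Longrightarrow>
      trace_inner M Y \<le> trace_inner M0 Y0"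
    by (auto simp: Ball_def)
  then have t: "?P (trace_inner M0 Y0)"
    unfolding P_iff by blast
  have max: "s \<le> trace_inner M0 Y0" if "?P s" for s
    using that max0 unfolding P_iff by blast
  have phi_eq: "phi k E w = trace_inner M0 Y0"
    unfolding phi_def using t max by (rule Greatest_equality)
  show ?attained
    using t unfolding P_iff phi_eq by blast
  show "trace_inner M Y \<le> phi k E w"
    if "M \<in> fractional_projections k" "Y \<in> weighted_gram_matrices E w" for M Y
    unfolding phi_eq using that by (rule max0)
qed

section \<open>Subadditivity\<close>

lemma matrix_add_rdistrib: "(A + B) ** C = A ** C + B ** C" for A B C :: "real^'n^'n"
  by (simp add: matrix_matrix_mult_def vec_eq_iff distrib_right sum.distrib)

lemma matrix_diff_sandwich: "P ** (A - B) ** Q = P ** A ** Q - P ** B ** Q"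
  for A B P Q :: "real^'n^'n"
  by (simp add: matrix_matrix_mult_def vec_eq_iff algebra_simps sum_subtractf sum_distrib_left)

lemma fractional_projections_conjugate:
  assumes "M \<in> fractional_projections k" and "orthogonal_matrix U"
  shows "U ** M ** transpose U \<in> fractional_projections k"
proof -
  have U: "transpose U ** U = mat 1" "U ** transpose U = mat 1"
    using assms(2) by (auto simp: orthogonal_matrix_def)
  have "mat 1 - U ** M ** transpose U = U ** (mat 1 - M) ** transpose U"
    by (simp add: U matrix_diff_sandwich)
  moreover have "trace (U ** M ** transpose U) = trace M"
    by (subst trace_mul_sym) (simp add: U matrix_mul_assoc)
  ultimately show ?thesis
    using assms(1)
    by (simp add: fractional_projections_def loewner_le_def trace_inner_mat_1 psd_sandwich)
qed

text \<open>
  If \<open>C = U\<^sup>T T\<close> with \<open>U\<close> orthogonal and \<open>T\<close> symmetric, then \<open>C\<^sup>T C = T\<^sup>2\<close> and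
  \<open>C C\<^sup>T = U\<^sup>T T\<^sup>2 U\<close>, so conjugating \<open>M\<close> by \<open>U\<^sup>T\<close> compensates for exchanging the two Gram matrices.
\<close>

lemma gram_swap:
  fixes C :: "real^'n^'n"
  assumes "M \<in> fractional_projections k"
  obtains N where "N \<in> fractional_projections k"
    and "trace_inner N (C ** transpose C) = trace_inner M (transpose C ** C)"
proof -
  obtain U :: "real^'n^'n" where U: "orthogonal_matrix U" and sym: "transpose (U ** C) = U ** C"
    by (rule orthogonal_symmetrizer)
  have UU: "transpose U ** U = mat 1" "U ** transpose U = mat 1"
    using U by (auto simp: orthogonal_matrix_def)
  define T where "T = U ** C"
  have T: "transpose T = T" using sym by (simp add: T_def)
  have C: "C = transpose U ** T"
    by (simp add: T_def matrix_mul_assoc UU)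
  have "transpose C ** C = T ** (U ** transpose U) ** T"
    unfolding C by (simp add: matrix_transpose_mul T matrix_mul_assoc)
  then have right: "transpose C ** C = T ** T"
    by (simp add: UU)
  have left: "C ** transpose C = transpose U ** (T ** T) ** U"
    unfolding C by (simp add: matrix_transpose_mul T matrix_mul_assoc)
  let ?N = "transpose U ** M ** transpose (transpose U)"
  have "trace_inner ?N (C ** transpose C)
      = trace (transpose U ** M ** (U ** transpose U) ** (T ** T) ** U)"
    unfolding trace_inner_def left by (simp add: matrix_mul_assoc)
  also have "\<dots> = trace (transpose U ** (M ** (T ** T) ** U))"
    by (simp add: UU matrix_mul_assoc)
  also have "\<dots> = trace (M ** (T ** T) ** (U ** transpose U))"
    by (subst trace_mul_sym) (simp add: matrix_mul_assoc)
  also have "\<dots> = trace_inner M (transpose C ** C)"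
    by (simp add: UU trace_inner_def right)
  finally have "trace_inner ?N (C ** transpose C) = trace_inner M (transpose C ** C)" .
  moreover have "?N \<in> fractional_projections k"
    using assms U by (intro fractional_projections_conjugate) (auto simp: orthogonal_matrix_transpose)
  ultimately show thesis using that by blast
qed

text \<open>
  Rescaling the vectors of a Gram representation keeps their orthogonality relations.
\<close>

lemma rescaled_gram_matrix:
  assumes "C ** transpose C \<in> weighted_gram_matrices E w"
  shows "(diag_mat d ** C) ** transpose (diag_mat d ** C)
    \<in> weighted_gram_matrices E (\<chi> i. (d $ i)\<^sup>2 * w $ i)"
proof -
  have "((diag_mat d ** C) ** transpose (diag_mat d ** C)) $ i $ j
      = d $ i * (C ** transpose C) $ i $ j * d $ j" for i j
  proof -
    have "(diag_mat d ** C) ** transpose (diag_mat d ** C)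
        = diag_mat d ** (C ** transpose C) ** diag_mat d"
      by (simp add: matrix_transpose_mul transpose_diag_mat matrix_mul_assoc)
    then show ?thesis by (simp add: diag_mat_mult_nth mult_diag_mat_nth)
  qed
  then show ?thesis
    using assms psd_gram[of "diag_mat d ** C"]
    unfolding weighted_gram_matrices_def entrywise_prod_adj_matrix_eq_0_iff
    by (auto simp: diag_vec_def vec_eq_iff power2_eq_square)
qed

text \<open>
  Let \<open>Y = C C\<^sup>T\<close> be optimal for \<open>x + y\<close>. Scale row \<open>i\<close> of \<open>C\<close> by \<open>a\<^sub>i = \<surd>s\<^sub>i\<close> and by
  \<open>b\<^sub>i = \<surd>(1 - s\<^sub>i)\<close>, where \<open>s\<^sub>i\<close> is the share of \<open>x\<^sub>i\<close> in \<open>x\<^sub>i + y\<^sub>i\<close>. Because \<open>a\<^sub>i\<^sup>2 + b\<^sub>i\<^sup>2 = 1\<close>, the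
  resulting factors \<open>A\<close> and \<open>B\<close> satisfy \<open>C\<^sup>T C = A\<^sup>T A + B\<^sup>T B\<close>, whereas \<open>C C\<^sup>T\<close> is in general different from
  \<open>A A\<^sup>T + B B\<^sup>T\<close>. The swap to \<open>C\<^sup>T C\<close> and back is therefore essential.
\<close>

lemma phi_subadditive:
  fixes E :: "'v::finite set set"
  assumes graph: "\<forall>e\<in>E. card e = 2" and k: "0 \<le> k" "k \<le> real CARD('v)"
    and x: "0 \<le> x" and y: "0 \<le> y"
  shows "phi k E (x + y) \<le> phi k E x + phi k E y"
proof -
  have nonneg: "0 \<le> x $ i" "0 \<le> y $ i" for i
    using x y by (auto simp: less_eq_vec_def)
  have "0 \<le> x + y" using x y by simp
  from phi_attained[OF graph k this] obtain M Y
    where M: "M \<in> fractional_projections k" and Y: "Y \<in> weighted_gram_matrices E (x + y)"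
      and phi: "phi k E (x + y) = trace_inner M Y" by blast
  obtain C :: "real^'v^'v" where C: "Y = C ** transpose C"
    using Y psd_obtain_factor unfolding weighted_gram_matrices_def by blast
  obtain N where N: "N \<in> fractional_projections k"
    and swap: "trace_inner N (transpose C ** C) = trace_inner M Y"
    using gram_swap[OF M, of "transpose C"] unfolding C by auto
  \<comment> \<open>Where \<open>x\<close> and \<open>y\<close> both vanish, any share in \<open>[0, 1]\<close> would do.\<close>
  define s where "s = (\<chi> i. if x $ i + y $ i = 0 then 1 else x $ i / (x $ i + y $ i))"
  define a b where "a = (\<chi> i. sqrt (s $ i))" and "b = (\<chi> i. sqrt (1 - s $ i))"
  have s: "0 \<le> s $ i" "s $ i \<le> 1" "s $ i * (x $ i + y $ i) = x $ i" for i
    using nonneg[of i] by (auto simp: s_def divide_le_eq_1)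
  have wx: "(\<chi> i. (a $ i)\<^sup>2 * (x + y) $ i) = x"
    using s by (simp add: a_def vec_eq_iff)
  have wy: "(\<chi> i. (b $ i)\<^sup>2 * (x + y) $ i) = y"
  proof -
    have "(1 - s $ i) * (x $ i + y $ i) = y $ i" for i
      using s(3)[of i] by (simp add: left_diff_distrib)
    then show ?thesis using s by (simp add: b_def vec_eq_iff)
  qed
  let ?A = "diag_mat a ** C" and ?B = "diag_mat b ** C"
  have decomp: "transpose C ** C = transpose ?A ** ?A + transpose ?B ** ?B"
  proof -
    have "diag_mat a ** diag_mat a + diag_mat b ** diag_mat b = mat 1"
      using s unfolding vec_eq_iff
      by (auto simp: diag_mat_mult_nth) (auto simp: diag_mat_def mat_def a_def b_def)
    then have "transpose C ** C
        = transpose C ** (diag_mat a ** diag_mat a + diag_mat b ** diag_mat b) ** C"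
      by simp
    then show ?thesis
      by (simp add: matrix_add_ldistrib matrix_add_rdistrib matrix_transpose_mul
          transpose_diag_mat matrix_mul_assoc)
  qed
  obtain K where K: "K \<in> fractional_projections k"
    and swapA: "trace_inner K (?A ** transpose ?A) = trace_inner N (transpose ?A ** ?A)"
    using gram_swap[OF N] by blast
  obtain L where L: "L \<in> fractional_projections k"
    and swapB: "trace_inner L (?B ** transpose ?B) = trace_inner N (transpose ?B ** ?B)"
    using gram_swap[OF N] by blast
  have "?A ** transpose ?A \<in> weighted_gram_matrices E x"
    using rescaled_gram_matrix[OF Y[unfolded C], of a] unfolding wx .
  from phi_upper[OF graph k x K this]
  have upperA: "trace_inner N (transpose ?A ** ?A) \<le> phi k E x" unfolding swapA .
  have "?B ** transpose ?B \<in> weighted_gram_matrices E y"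
    using rescaled_gram_matrix[OF Y[unfolded C], of b] unfolding wy .
  from phi_upper[OF graph k y L this]
  have upperB: "trace_inner N (transpose ?B ** ?B) \<le> phi k E y" unfolding swapB .
  show ?thesis
    using upperA upperB unfolding phi swap[symmetric] decomp trace_inner_add_right by simp
qed

section \<open>Monotonicity, homogeneity and definiteness\<close>

text \<open>
  Adding the diagonal matrix of \<open>y - x\<close> turns a matrix feasible for \<open>x\<close> into one feasible for
  \<open>y\<close>, and the objective does not decrease because the diagonal of \<open>M\<close> is nonnegative.
\<close>

lemma phi_mono:
  fixes E :: "'v::finite set set"
  assumes graph: "\<forall>e\<in>E. card e = 2" and k: "0 \<le> k" "k \<le> real CARD('v)"
    and x: "0 \<le> x" and "x \<le> y"
  shows "phi k E x \<le> phi k E y"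
proof -
  have y: "0 \<le> y" and d: "0 \<le> y - x" using x \<open>x \<le> y\<close> by auto
  from phi_attained[OF graph k x] obtain M Y
    where M: "M \<in> fractional_projections k" and Y: "Y \<in> weighted_gram_matrices E x"
      and phi: "phi k E x = trace_inner M Y" by blast
  let ?D = "diag_mat (y - x)"
  have "Y + ?D \<in> weighted_gram_matrices E y"
    using Y diag_mat_weighted_gram[OF graph d]
    unfolding weighted_gram_matrices_def entrywise_prod_adj_matrix_eq_0_iff
    by (auto simp: psd_add diag_vec_def vec_eq_iff)
  from phi_upper[OF graph k y M this]
  have "trace_inner M Y + trace_inner M ?D \<le> phi k E y"
    by (simp add: trace_inner_add_right)
  moreover have "0 \<le> trace_inner M ?D"
    using M d unfolding trace_inner_def trace_def fractional_projections_def
    by (auto simp: mult_diag_mat_nth psd_diag_nonneg less_eq_vec_def intro!: sum_nonneg)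
  ultimately show ?thesis using phi by linarith
qed

lemma phi_scaleR_ge:
  fixes E :: "'v::finite set set"
  assumes graph: "\<forall>e\<in>E. card e = 2" and k: "0 \<le> k" "k \<le> real CARD('v)"
    and c: "0 \<le> c" and x: "0 \<le> x"
  shows "c * phi k E x \<le> phi k E (c *\<^sub>R x)"
proof -
  from phi_attained[OF graph k x] obtain M Y
    where M: "M \<in> fractional_projections k" and Y: "Y \<in> weighted_gram_matrices E x"
      and phi: "phi k E x = trace_inner M Y" by blast
  have "c *\<^sub>R Y \<in> weighted_gram_matrices E (c *\<^sub>R x)"
    using Y c unfolding weighted_gram_matrices_def entrywise_prod_adj_matrix_eq_0_iff
    by (auto simp: psd_scaleR diag_vec_def vec_eq_iff)
  moreover have "0 \<le> c *\<^sub>R x" using c x by (simp add: less_eq_vec_def)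
  ultimately have "trace_inner M (c *\<^sub>R Y) \<le> phi k E (c *\<^sub>R x)"
    using phi_upper[OF graph k] M by blast
  then show ?thesis by (simp add: phi trace_inner_scaleR_right)
qed

text \<open>A positive semidefinite matrix of trace zero vanishes, so \<open>Y = 0\<close> is the only candidate.\<close>

lemma phi_zero:
  fixes E :: "'v::finite set set"
  assumes "\<forall>e\<in>E. card e = 2" and "0 \<le> k" and "k \<le> real CARD('v)"
  shows "phi k E 0 = 0"
proof -
  from phi_attained[OF assms, of 0] obtain M Y
    where Y: "Y \<in> weighted_gram_matrices E 0" and phi: "phi k E 0 = trace_inner M Y" by auto
  have "Y $ i $ j = 0" for i j
    using psd_entry_le_trace[of Y i j] trace_weighted_gram_matrix[OF Y] Y
    by (simp add: weighted_gram_matrices_def)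
  then show ?thesis
    by (simp add: phi trace_inner_def trace_def matrix_matrix_mult_def)
qed

lemma phi_scaleR:
  fixes E :: "'v::finite set set"
  assumes graph: "\<forall>e\<in>E. card e = 2" and k: "0 \<le> k" "k \<le> real CARD('v)"
    and c: "0 \<le> c" and x: "0 \<le> x"
  shows "phi k E (c *\<^sub>R x) = c * phi k E x"
proof (cases "c = 0")
  case True
  then show ?thesis by (simp add: phi_zero[OF graph k])
next
  case False
  with c have "0 < c" by simp
  \<comment> \<open>The reverse inequality is the same bound for the factor \<open>1 / c\<close> and the vector \<open>c x\<close>.\<close>
  have "0 \<le> c *\<^sub>R x" using c x by (simp add: less_eq_vec_def)
  then have "(1 / c) * phi k E (c *\<^sub>R x) \<le> phi k E x"
    using phi_scaleR_ge[OF graph k, of "1 / c" "c *\<^sub>R x"] \<open>0 < c\<close> by simp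
  then have "phi k E (c *\<^sub>R x) \<le> c * phi k E x"
    using \<open>0 < c\<close> by (simp add: field_simps)
  with phi_scaleR_ge[OF graph k c x] show ?thesis by simp
qed

text \<open>The value at the feasible pair \<open>M = (k / n) I\<close> and \<open>Y\<close> the diagonal matrix of \<open>w\<close>.\<close>

lemma phi_ge_average:
  fixes E :: "'v::finite set set"
  assumes graph: "\<forall>e\<in>E. card e = 2" and k: "0 \<le> k" "k \<le> real CARD('v)" and w: "0 \<le> w"
  shows "k / real CARD('v) * (\<Sum>i\<in>UNIV. w $ i) \<le> phi k E w"
  using phi_upper[OF graph k w scaled_identity_fractional_projection[OF k]
      diag_mat_weighted_gram[OF graph w]]
    trace_weighted_gram_matrix[OF diag_mat_weighted_gram[OF graph w]]
  by (simp add: trace_inner_scaleR_left trace_inner_mat_1)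

theorem theorem16:
  fixes E :: "'v::finite set set" and k :: real
  assumes "\<forall>e\<in>E. card e = 2"
    and "0 < k"
    and "k \<le> real CARD('v)"
  shows "positive_definite_gauge (phi k E) \<and> mono_on {0..} (phi k E)"
proof (intro conjI)
  have k: "0 \<le> k" using assms(2) by simp
  note facts = assms(1) k assms(3)
  show "mono_on {0..} (phi k E)"
    by (rule mono_onI) (auto intro: phi_mono[OF facts])
  have "0 \<le> phi k E x \<and> (phi k E x = 0 \<longleftrightarrow> x = 0)" if x: "0 \<le> x" for x
  proof (cases "x = 0")
    case True
    then show ?thesis by (simp add: phi_zero[OF facts])
  next
    case False
    have nonneg: "0 \<le> x $ i" for i using x by (simp add: less_eq_vec_def)
    from False obtain i where "x $ i \<noteq> 0" by (auto simp: vec_eq_iff)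
    with nonneg have "0 < (\<Sum>i\<in>UNIV. x $ i)"
      by (intro sum_pos2[of _ i]) (auto simp: order_less_le)
    with assms(2) have "0 < k / real CARD('v) * (\<Sum>i\<in>UNIV. x $ i)" by simp
    with phi_ge_average[OF facts x] False show ?thesis by linarith
  qed
  then show "positive_definite_gauge (phi k E)"
    unfolding positive_definite_gauge_def
    using phi_scaleR[OF facts] phi_subadditive[OF facts] by blast
qed

end
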